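(* Let $X$ be a distance-regular graph of diameter $d\geq 2$ with intersection numbers $b_i,c_i$. Let $0\leq j\leq d-2$, assume $b_j>c_{j+1}$, and put $C=b_j/c_{j+1}$. Then for every $1\leq s\leq j+1$, $$b_{j+1}\left(\sum_{t=1}^{s}\frac{1}{b_{t-1}}+\sum_{t=1}^{j+2-s}\frac{1}{b_{t-1}}\right)+c_{j+2}\sum_{t=1}^{j+1}\frac{1}{b_{t-1}}\geq 1-\frac{4}{C-1}.$$
   Context: A connected graph $X$ of diameter $d$ is distance-regular if there are integers $a_i,b_i,c_i$ ($0\le i\le d$) such that for all vertices $v,w$ with $\mathrm{dist}(v,w)=i$, the vertex $w$ has exactly $c_i$ neighbours at distance $i-1$ from $v$, $a_i$ neighbours at distance $i$ from $v$, and $b_i$ neighbours at distance $i+1$ from $v$. Then $X$ is $k$-regular with $k=b_0$, $c_0=b_d=0$, $c_1=1$ and $a_i+b_i+c_i=k$. *)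

theory Defs
  imports Complex_Main
begin

definition simple_graph :: "'a set \<Rightarrow> ('a \<Rightarrow> 'a \<Rightarrow> bool) \<Rightarrow> bool" where
  "simple_graph V E \<longleftrightarrow>
     (\<forall>x y. E x y \<longrightarrow> x \<in> V \<and> y \<in> V) \<and>
     (\<forall>x y. E x y \<longrightarrow> E y x) \<and> (\<forall>x. \<not> E x x)"

fun walk :: "('a \<Rightarrow> 'a \<Rightarrow> bool) \<Rightarrow> nat \<Rightarrow> 'a \<Rightarrow> 'a \<Rightarrow> bool" where
  "walk E 0 v w = (v = w)"
| "walk E (Suc n) v w = (\<exists>u. E v u \<and> walk E n u w)"

definition gdist :: "('a \<Rightarrow> 'a \<Rightarrow> bool) \<Rightarrow> 'a \<Rightarrow> 'a \<Rightarrow> nat" where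
  "gdist E v w = (LEAST n. walk E n v w)"

definition connected_graph :: "'a set \<Rightarrow> ('a \<Rightarrow> 'a \<Rightarrow> bool) \<Rightarrow> bool" where
  "connected_graph V E \<longleftrightarrow> (\<forall>v\<in>V. \<forall>w\<in>V. \<exists>n. walk E n v w)"

definition has_diameter :: "'a set \<Rightarrow> ('a \<Rightarrow> 'a \<Rightarrow> bool) \<Rightarrow> nat \<Rightarrow> bool" where
  "has_diameter V E d \<longleftrightarrow>
     (\<forall>v\<in>V. \<forall>w\<in>V. gdist E v w \<le> d) \<and> (\<exists>v\<in>V. \<exists>w\<in>V. gdist E v w = d)"

definition distance_regular ::
  "'a set \<Rightarrow> ('a \<Rightarrow> 'a \<Rightarrow> bool) \<Rightarrow> nat \<Rightarrow> (nat \<Rightarrow> nat) \<Rightarrow> (nat \<Rightarrow> nat) \<Rightarrow> (nat \<Rightarrow> nat) \<Rightarrow> bool" where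
  "distance_regular V E d a b c \<longleftrightarrow>
     simple_graph V E \<and> finite V \<and> V \<noteq> {} \<and> connected_graph V E \<and> has_diameter V E d \<and>
     (\<forall>i\<le>d. \<forall>v\<in>V. \<forall>w\<in>V. gdist E v w = i \<longrightarrow>
        card {u. E w u \<and> gdist E v u + 1 = i} = c i \<and>
        card {u. E w u \<and> gdist E v u = i} = a i \<and>
        card {u. E w u \<and> gdist E v u = i + 1} = b i)"

end

theory Submission
  imports Defs
begin

text \<open>Put \<open>m = j + 1\<close>. Fix vertices \<open>v\<close>, \<open>y\<close> and let \<open>w\<close> move away from \<open>v\<close> along a random
  geodesic. The step from distance \<open>t - 1\<close> to distance \<open>t\<close> has \<open>b (t - 1)\<close> equally likely
  outcomes, and at most \<open>b m\<close> (respectively \<open>c (m + 1)\<close>) of them carry \<open>w\<close> from the ball of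
  radius \<open>m\<close> about \<open>y\<close> to its complement (respectively back). So the probability of such a
  crossing within \<open>s\<close> steps is at most \<open>b m\<close> (respectively \<open>c (m + 1)\<close>) times
  \<open>\<Sum>t = 1..s. 1 / b (t - 1)\<close>.

  Now take \<open>v\<close>, \<open>w\<close> at distance \<open>m + 1\<close> and \<open>u\<close> on a geodesic between them, at distance \<open>s\<close>
  from \<open>v\<close>. By the first estimate most of the sphere of radius \<open>m\<close> about \<open>u\<close> lies in both balls
  of radius \<open>m\<close> about \<open>v\<close> and \<open>w\<close>; by the second estimate few vertices of the sphere of
  radius \<open>m\<close> about \<open>v\<close> lie in the ball about \<open>w\<close>. The smaller spheres about \<open>v\<close> are
  negligible, because sphere sizes grow at least by the factor \<open>C\<close> up to radius \<open>m\<close>.\<close>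

section \<open>Walks, graph distance and double counting\<close>

lemma walk_append: "walk E m x y \<Longrightarrow> walk E n y z \<Longrightarrow> walk E (m + n) x z"
  by (induction m arbitrary: x) auto

lemma gdist_le_walk: "walk E n x y \<Longrightarrow> gdist E x y \<le> n"
  unfolding gdist_def by (rule Least_le)

lemma gdist_self [simp]: "gdist E x x = 0"
  using gdist_le_walk[of E 0 x x] by simp

lemma sum_card_swap:
  assumes "finite A" "finite B"
  shows "(\<Sum>x\<in>A. card {y \<in> B. R x y}) = (\<Sum>y\<in>B. card {x \<in> A. R x y})"
proof -
  have "(\<Sum>x\<in>A. card {y \<in> B. R x y}) = (\<Sum>x\<in>A. \<Sum>y\<in>B. if R x y then 1 else 0)"
    using assms by (simp add: sum.If_cases Int_def)
  also have "\<dots> = (\<Sum>y\<in>B. \<Sum>x\<in>A. if R x y then 1 else 0)"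
    by (rule sum.swap)
  finally show ?thesis
    using assms by (simp add: sum.If_cases Int_def)
qed

section \<open>Distances and geodesics in a distance-regular graph\<close>

locale distance_regular_graph =
  fixes V :: "'a set" and E :: "'a \<Rightarrow> 'a \<Rightarrow> bool" and d :: nat and a b c :: "nat \<Rightarrow> nat"
  assumes dist_reg: "distance_regular V E d a b c"
begin

abbreviation dist where "dist \<equiv> gdist E"

definition sphere :: "'a \<Rightarrow> nat \<Rightarrow> 'a set" where
  "sphere v i = {w \<in> V. dist v w = i}"

lemma finite_V [simp]: "finite V"
  and E_sym: "E x y \<Longrightarrow> E y x"
  and E_V: "E x y \<Longrightarrow> x \<in> V \<and> y \<in> V"
  and dist_le: "x \<in> V \<Longrightarrow> y \<in> V \<Longrightarrow> dist x y \<le> d"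
  using dist_reg
  by (auto simp: distance_regular_def simple_graph_def has_diameter_def)

lemma sphereD: "w \<in> sphere v i \<Longrightarrow> w \<in> V" "w \<in> sphere v i \<Longrightarrow> dist v w = i"
  by (simp_all add: sphere_def)

lemma finite_sphere [simp]: "finite (sphere v i)"
  by (simp add: sphere_def)

lemma walk_dist: "x \<in> V \<Longrightarrow> y \<in> V \<Longrightarrow> walk E (dist x y) x y"
  using dist_reg unfolding distance_regular_def connected_graph_def gdist_def
  by (meson LeastI_ex)

lemma walk_sym: "walk E n x y \<Longrightarrow> walk E n y x"
proof (induction n arbitrary: x)
  case (Suc n)
  then obtain u where "E x u" "walk E n u y" by auto
  then have "walk E (n + 1) y x"
    using Suc.IH E_sym by (intro walk_append[where y = u]) auto
  then show ?case by simp
qed auto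

lemma dist_sym: "dist x y = dist y x"
  unfolding gdist_def using walk_sym by metis

lemma dist_eq_0: "x \<in> V \<Longrightarrow> y \<in> V \<Longrightarrow> dist x y = 0 \<longleftrightarrow> x = y"
  using walk_dist[of x y] by auto

lemma dist_triangle:
  assumes "x \<in> V" "y \<in> V" "z \<in> V"
  shows "dist x z \<le> dist x y + dist y z"
  using assms by (intro gdist_le_walk walk_append[of _ _ _ y] walk_dist)

lemma dist_edge_le: "E x y \<Longrightarrow> dist x y \<le> 1"
  by (rule gdist_le_walk) auto

lemma dist_adj:
  assumes "v \<in> V" "E w u"
  shows "dist v u \<le> Suc (dist v w)" "dist v w \<le> Suc (dist v u)"
  using assms dist_triangle[of v w u] dist_triangle[of v u w]
    dist_edge_le[of w u] dist_edge_le[of u w] E_V E_sym by fastforce+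

lemma geodesic_point:
  assumes "x \<in> V" "y \<in> V" "dist x y = s + t"
  obtains u where "u \<in> V" "dist x u = s" "dist u y = t"
proof -
  have "\<exists>u\<in>V. walk E s x u \<and> walk E t u y" if "walk E (s + t) x y" "x \<in> V" for x
    using that
  proof (induction s arbitrary: x)
    case (Suc s)
    then obtain z where "E x z" "walk E (s + t) z y" by auto
    then show ?case using Suc.IH[of z] E_V by auto
  qed auto
  then obtain u where u: "u \<in> V" "walk E s x u" "walk E t u y"
    using walk_dist assms by metis
  then have "dist x u \<le> s" "dist u y \<le> t" by (auto intro: gdist_le_walk)
  then show ?thesis
    using dist_triangle[of x u y] u assms by (intro that[of u]) auto
qed

lemma ex_pair_at_dist:
  assumes "i \<le> d"
  obtains x y where "x \<in> V" "y \<in> V" "dist x y = i"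
proof -
  obtain x y where xy: "x \<in> V" "y \<in> V" "dist x y = i + (d - i)"
    using dist_reg assms by (auto simp: distance_regular_def has_diameter_def)
  then obtain u where "u \<in> V" "dist x u = i" by (rule geodesic_point)
  then show ?thesis using xy that by blast
qed

section \<open>Positivity and monotonicity of the parameters \<open>b\<close> and
  \<open>c\<close>\<close>

lemma
  assumes "v \<in> V" "w \<in> V"
  shows card_c: "card {u. E w u \<and> dist v u + 1 = dist v w} = c (dist v w)"
    and card_a: "card {u. E w u \<and> dist v u = dist v w} = a (dist v w)"
    and card_b: "card {u. E w u \<and> dist v u = dist v w + 1} = b (dist v w)"
  using dist_reg assms dist_le[of v w] by (auto simp: distance_regular_def)

lemma finite_nbrs [simp]: "finite {u. E w u \<and> P u}"
  by (rule finite_subset[OF _ finite_V]) (use E_V in auto)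

lemma c_pos:
  assumes "0 < i" "i \<le> d"
  shows "0 < c i"
proof -
  obtain x y where xy: "x \<in> V" "y \<in> V" "dist x y = i"
    using ex_pair_at_dist assms by blast
  then have "dist x y = (i - 1) + 1" using assms by simp
  then obtain u where u: "u \<in> V" "dist x u = i - 1" "dist u y = 1"
    using geodesic_point xy by metis
  then have "walk E 1 u y" using walk_dist xy by metis
  then have "E y u" using E_sym by auto
  then have "{u. E y u \<and> dist x u + 1 = dist x y} \<noteq> {}"
    using u xy assms by auto
  then show ?thesis
    using card_c[of x y] xy by (metis card_gt_0_iff finite_nbrs)
qed

lemma b_pos:
  assumes "i < d"
  shows "0 < b i"
proof -
  obtain x y where xy: "x \<in> V" "y \<in> V" "dist x y = i + 1"
    using ex_pair_at_dist[of "i + 1"] assms by auto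
  then obtain u where u: "u \<in> V" "dist x u = i" "dist u y = 1"
    using geodesic_point by metis
  then have "walk E 1 u y" using walk_dist xy by metis
  then have "{y. E u y \<and> dist x y = dist x u + 1} \<noteq> {}"
    using u xy by auto
  then show ?thesis
    using card_b[of x u] xy u by (metis card_gt_0_iff finite_nbrs)
qed

text \<open>Move the base point one step along a geodesic, from \<open>v\<close> to
  \<open>v'\<close>. By the triangle inequality, neighbours of \<open>w\<close> farther from
  \<open>v\<close> are also farther from \<open>v'\<close>, and neighbours of \<open>w\<close>
  closer to \<open>v'\<close> are also closer to \<open>v\<close>.\<close>

lemma
  assumes "Suc i \<le> d"
  shows b_Suc_le: "b (Suc i) \<le> b i" and c_le_Suc: "c i \<le> c (Suc i)"
proof -
  obtain v w where vw: "v \<in> V" "w \<in> V" "dist v w = 1 + i"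
    using ex_pair_at_dist[of "1 + i"] assms by auto
  then obtain v' where v': "v' \<in> V" "dist v v' = 1" "dist v' w = i"
    by (rule geodesic_point)
  have near: "dist v u \<le> dist v' u + 1" "dist v' u \<le> i + 1" "i \<le> dist v u" if "E w u" for u
    using dist_triangle[of v v' u] dist_adj[OF _ that, of v'] dist_adj[OF _ that, of v]
      E_V[OF that] v' vw by simp_all
  have "{u. E w u \<and> dist v u = dist v w + 1} \<subseteq> {u. E w u \<and> dist v' u = dist v' w + 1}"
  proof (intro subsetI CollectI conjI; elim CollectE conjE)
    fix u assume "E w u" "dist v u = dist v w + 1"
    then show "dist v' u = dist v' w + 1" using near[of u] vw v' by linarith
  qed
  from card_mono[OF finite_nbrs this] show "b (Suc i) \<le> b i"
    using card_b[of v w] card_b[of v' w] vw v' by simp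
  have "{u. E w u \<and> dist v' u + 1 = dist v' w} \<subseteq> {u. E w u \<and> dist v u + 1 = dist v w}"
  proof (intro subsetI CollectI conjI; elim CollectE conjE)
    fix u assume "E w u" "dist v' u + 1 = dist v' w"
    then show "dist v u + 1 = dist v w" using near[of u] vw v' by linarith
  qed
  from card_mono[OF finite_nbrs this] show "c i \<le> c (Suc i)"
    using card_c[of v w] card_c[of v' w] vw v' by simp
qed

section \<open>Intersections of two spheres\<close>

definition nbr_count :: "nat \<Rightarrow> nat \<Rightarrow> nat" where
  "nbr_count i l = (if l + 1 = i then c i else if l = i then a i else if l = i + 1 then b i else 0)"

lemma card_nbrs_sphere:
  assumes "v \<in> V" "w \<in> V"
  shows "card {u \<in> sphere v l. E w u} = nbr_count (dist v w) l"
proof -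
  have eq: "{u \<in> sphere v l. E w u} = {u. E w u \<and> dist v u = l}"
    using E_V by (auto simp: sphere_def)
  consider "l + 1 = dist v w" | "l = dist v w" | "l = dist v w + 1"
    | "l + 1 \<noteq> dist v w \<and> l \<noteq> dist v w \<and> l \<noteq> dist v w + 1" by blast
  then show ?thesis
  proof cases
    case 1
    then have "{u. E w u \<and> dist v u = l} = {u. E w u \<and> dist v u + 1 = dist v w}" by auto
    then show ?thesis using 1 card_c[OF assms] eq by (simp add: nbr_count_def)
  next
    case 4
    have "{u. E w u \<and> dist v u = l} = {}"
      using 4 dist_adj[OF assms(1), of w] by fastforce
    then show ?thesis using 4 eq by (simp add: nbr_count_def)
  qed (use card_a[OF assms] card_b[OF assms] eq in \<open>auto simp: nbr_count_def\<close>)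
qed

text \<open>Usually written p(h; i, l) with h = \<open>dist v w\<close>. The vertices remain as
  arguments because dependence on the distance alone is only established in
  \<open>inter_eq\<close>.\<close>

definition inter :: "'a \<Rightarrow> 'a \<Rightarrow> nat \<Rightarrow> nat \<Rightarrow> nat" where
  "inter v w i l = card (sphere v i \<inter> sphere w l)"

lemma sum_sphere_by_dist:
  assumes "w \<in> V"
  shows "(\<Sum>y\<in>sphere v i. f (dist w y)) = (\<Sum>m\<le>d. f m * inter v w i m)"
proof -
  have "(\<Sum>y\<in>sphere v i. f (dist w y))
      = (\<Sum>m\<le>d. \<Sum>y\<in>{y \<in> sphere v i. dist w y = m}. f (dist w y))"
    using dist_le[OF assms] by (intro sum.group[symmetric]) (auto simp: sphere_def)
  also have "\<dots> = (\<Sum>m\<le>d. f m * inter v w i m)"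
  proof (rule sum.cong[OF refl])
    fix m
    have "{y \<in> sphere v i. dist w y = m} = sphere v i \<inter> sphere w m"
      by (auto simp: sphere_def)
    then show "(\<Sum>y\<in>{y \<in> sphere v i. dist w y = m}. f (dist w y)) = f m * inter v w i m"
      by (simp add: inter_def sphere_def)
  qed
  finally show ?thesis .
qed

text \<open>Double count the adjacent pairs \<open>y\<close>, \<open>z\<close> with \<open>y\<close>
  in \<open>sphere v i\<close> and \<open>z\<close> in \<open>sphere w l\<close>: the left side
  sorts them by \<open>dist w y\<close>, the right side by \<open>dist v z\<close>.\<close>

lemma inter_recurrence:
  assumes "v \<in> V" "w \<in> V"
  shows "(\<Sum>m\<le>d. nbr_count m l * inter v w i m) = (\<Sum>m\<le>d. nbr_count m i * inter v w m l)"
proof -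
  have "(\<Sum>m\<le>d. nbr_count m l * inter v w i m) = (\<Sum>y\<in>sphere v i. card {z \<in> sphere w l. E y z})"
    unfolding sum_sphere_by_dist[OF assms(2), symmetric]
    using assms by (intro sum.cong refl) (simp add: card_nbrs_sphere sphereD)
  also have "\<dots> = (\<Sum>z\<in>sphere w l. card {y \<in> sphere v i. E z y})"
    by (subst sum_card_swap) (auto intro!: sum.cong arg_cong[of _ _ card] intro: E_sym)
  also have "\<dots> = (\<Sum>z\<in>sphere w l. nbr_count (dist v z) i)"
    using assms by (intro sum.cong refl) (simp add: card_nbrs_sphere sphereD)
  also have "\<dots> = (\<Sum>m\<le>d. nbr_count m i * inter v w m l)"
    using sum_sphere_by_dist[OF assms(1), of "\<lambda>m. nbr_count m i" w l]
    by (simp add: inter_def Int_commute)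
  finally show ?thesis .
qed

text \<open>Existence of the intersection numbers. In the recurrence above for \<open>l\<close>, the term with
  \<open>inter v w i (l + 1)\<close> has the nonzero coefficient \<open>c (l + 1)\<close>, and all other terms involve only
  second indices at most \<open>l\<close>.\<close>
lemma inter_eq:
  assumes "v \<in> V" "w \<in> V" "v' \<in> V" "w' \<in> V" "dist v w = dist v' w'"
  shows "inter v w i l = inter v' w' i l"
proof (induction l arbitrary: i rule: less_induct)
  case (less l)
  show ?case
  proof (cases l)
    case 0
    have "sphere y 0 = {y}" if "y \<in> V" for y
      using that dist_eq_0[OF that] by (auto simp: sphere_def)
    then have "inter x y i 0 = (if dist x y = i then 1 else 0)" if "y \<in> V" for x y
      using that by (simp add: inter_def sphere_def)
    then show ?thesis using assms 0 by simp
  next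
    case (Suc n)
    show ?thesis
    proof (cases "l \<le> d")
      case True
      have split: "(\<Sum>m\<le>d. nbr_count m n * inter x y i m)
          = (\<Sum>m\<le>n. nbr_count m n * inter x y i m) + c l * inter x y i l" for x y
      proof -
        have "(\<Sum>m\<le>d. nbr_count m n * inter x y i m) = (\<Sum>m\<le>l. nbr_count m n * inter x y i m)"
          using True Suc by (intro sum.mono_neutral_right) (auto simp: nbr_count_def)
        then show ?thesis using Suc by (simp add: nbr_count_def)
      qed
      \<comment> \<open>After the recurrence both sides have second index \<open>n < l\<close> but
        all first indices, which is why the induction keeps \<open>i\<close> arbitrary.\<close>
      have "(\<Sum>m\<le>d. nbr_count m n * inter v w i m) = (\<Sum>m\<le>d. nbr_count m n * inter v' w' i m)"
        unfolding inter_recurrence[OF assms(1,2)] inter_recurrence[OF assms(3,4)]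
        using less Suc by simp
      moreover have "(\<Sum>m\<le>n. nbr_count m n * inter v w i m) = (\<Sum>m\<le>n. nbr_count m n * inter v' w' i m)"
        using less Suc by (intro sum.cong) auto
      ultimately show ?thesis
        using split c_pos[of l] True Suc by simp
    next
      case False
      then have "sphere x l = {}" if "x \<in> V" for x
        using dist_le[OF that] by (auto simp: sphere_def)
      then show ?thesis using assms by (simp add: inter_def)
    qed
  qed
qed

section \<open>Sphere sizes and crossing estimates\<close>

lemma card_sphere_eq: "v \<in> V \<Longrightarrow> w \<in> V \<Longrightarrow> card (sphere v i) = card (sphere w i)"
  using inter_eq[of v v w w i i] by (simp add: inter_def)

text \<open>Both sides count the edges between two consecutive spheres.\<close>

lemma card_sphere_Suc:
  assumes "v \<in> V"
  shows "card (sphere v (Suc i)) * c (Suc i) = card (sphere v i) * b i"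
proof -
  have "(\<Sum>x\<in>sphere v i. card {y \<in> sphere v (Suc i). E x y})
      = (\<Sum>y\<in>sphere v (Suc i). card {x \<in> sphere v i. E y x})"
    by (subst sum_card_swap) (auto intro!: sum.cong arg_cong[of _ _ card] intro: E_sym)
  moreover have "card {y \<in> sphere v (Suc i). E x y} = b i" if "x \<in> sphere v i" for x
    using that assms by (simp add: card_nbrs_sphere sphereD nbr_count_def)
  moreover have "card {x \<in> sphere v i. E y x} = c (Suc i)" if "y \<in> sphere v (Suc i)" for y
    using that assms by (simp add: card_nbrs_sphere sphereD nbr_count_def)
  ultimately show ?thesis by simp
qed

lemma sphere_nonempty:
  assumes "v \<in> V" "i \<le> d"
  shows "0 < card (sphere v i)"
proof -
  obtain x y where "x \<in> V" "y \<in> sphere x i"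
    using ex_pair_at_dist[OF assms(2)] unfolding sphere_def by blast
  then have "0 < card (sphere x i)" by (auto simp: card_gt_0_iff)
  then show ?thesis using card_sphere_eq[of v x] assms \<open>x \<in> V\<close> by simp
qed

text \<open>The union bound over the steps of a random geodesic from \<open>v\<close>, written as a
  count. \<open>Q\<close> is a set of distances from \<open>y\<close>, so that one lemma covers both
  leaving and entering a ball. Each induction step double counts the edges from
  \<open>sphere v s\<close> to the bad vertices of the next sphere.\<close>

lemma card_crossing_le:
  assumes "v \<in> V" "y \<in> V" "dist y v \<notin> Q" "s \<le> d"
    and rate: "\<And>x. x \<in> V \<Longrightarrow> dist y x \<notin> Q \<Longrightarrow> card {x'. E x x' \<and> dist y x' \<in> Q} \<le> r"
  shows "real (card {x \<in> sphere v s. dist y x \<in> Q})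
    \<le> card (sphere v s) * (r * (\<Sum>t = 1..s. 1 / real (b (t - 1))))"
  using \<open>s \<le> d\<close>
proof (induction s)
  case 0
  have "{x \<in> sphere v 0. dist y x \<in> Q} = {}"
    using assms by (auto simp: sphere_def dist_eq_0)
  then show ?case by (simp only: card.empty) simp
next
  case (Suc s)
  define Bad where "Bad i = {x \<in> sphere v i. dist y x \<in> Q}" for i
  define k where "k i = real (card (sphere v i))" for i
  define \<Sigma> where "\<Sigma> = (\<Sum>t = 1..s. 1 / real (b (t - 1)))"
  have fin: "finite (Bad i)" for i by (simp add: Bad_def)
  have "card {x' \<in> sphere v s. E x x'} = c (Suc s)" if "x \<in> Bad (Suc s)" for x
    using that \<open>v \<in> V\<close> sphereD[of x v "Suc s"]
    by (simp add: Bad_def card_nbrs_sphere nbr_count_def)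
  then have "card (Bad (Suc s)) * c (Suc s) = (\<Sum>x\<in>Bad (Suc s). card {x' \<in> sphere v s. E x x'})"
    by simp
  also have "\<dots> = (\<Sum>x\<in>sphere v s. card {x' \<in> Bad (Suc s). E x x'})"
    using fin by (subst sum_card_swap) (auto intro!: sum.cong arg_cong[of _ _ card] intro: E_sym)
  \<comment> \<open>All \<open>b s\<close> successors of a bad vertex may be bad; a good vertex has
    at most \<open>r\<close> bad successors. Granting \<open>r\<close> to bad vertices too lets the
    sum split.\<close>
  also have "\<dots> \<le> (\<Sum>x\<in>sphere v s. (if x \<in> Bad s then b s else 0) + r)"
  proof (rule sum_mono)
    fix x assume x: "x \<in> sphere v s"
    show "card {x' \<in> Bad (Suc s). E x x'} \<le> (if x \<in> Bad s then b s else 0) + r"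
    proof (cases "x \<in> Bad s")
      case True
      have "card {x' \<in> Bad (Suc s). E x x'} \<le> card {x' \<in> sphere v (Suc s). E x x'}"
        by (rule card_mono) (auto simp: Bad_def)
      also have "\<dots> = b s"
        using x assms by (simp add: card_nbrs_sphere sphereD nbr_count_def)
      finally show ?thesis using True by simp
    next
      case False
      have "card {x' \<in> Bad (Suc s). E x x'} \<le> card {x'. E x x' \<and> dist y x' \<in> Q}"
        by (rule card_mono) (auto simp: Bad_def)
      also have "\<dots> \<le> r" using False x by (intro rate) (auto simp: Bad_def sphere_def)
      finally show ?thesis using False by simp
    qed
  qed
  also have "\<dots> = card (Bad s) * b s + card (sphere v s) * r"
  proof -
    have "sphere v s \<inter> Bad s = Bad s" by (auto simp: Bad_def)
    then show ?thesis by (simp add: sum.distrib sum.If_cases)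
  qed
  finally have "real (card (Bad (Suc s)) * c (Suc s)) \<le> real (card (Bad s) * b s + card (sphere v s) * r)"
    by (rule of_nat_mono)
  then have "real (card (Bad (Suc s))) * c (Suc s) \<le> real (card (Bad s)) * b s + k s * r"
    by (simp add: k_def)
  also have "\<dots> \<le> k s * (r * \<Sigma>) * b s + k s * r"
    using Suc by (intro add_mono mult_right_mono) (auto simp: Bad_def k_def \<Sigma>_def)
  \<comment> \<open>Pulling out \<open>b s\<close> turns \<open>k s * r\<close> into the new summand
    \<open>1 / b s\<close>, the one for \<open>t = s + 1\<close>.\<close>
  also have "\<dots> = (k s * b s) * (r * (\<Sigma> + 1 / b s))"
    using b_pos[of s] Suc.prems by (simp add: field_simps)
  also have "k s * b s = k (Suc s) * c (Suc s)"
    unfolding k_def using card_sphere_Suc[OF \<open>v \<in> V\<close>, of s] by (metis of_nat_mult)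
  finally have "real (card (Bad (Suc s))) * c (Suc s) \<le> (k (Suc s) * (r * (\<Sigma> + 1 / b s))) * c (Suc s)"
    by (simp add: mult_ac)
  then have "real (card (Bad (Suc s))) \<le> k (Suc s) * (r * (\<Sigma> + 1 / b s))"
    using c_pos[of "Suc s"] Suc.prems by simp
  then show ?case by (simp add: Bad_def k_def \<Sigma>_def)
qed

text \<open>By \<open>inter_eq\<close> the count is the same for every \<open>w'\<close> in
  \<open>sphere v s\<close>, so it equals its average over that sphere. Swapping the sums fixes
  \<open>z\<close> and lets the other vertex move away from \<open>v\<close>, where
  \<open>card_crossing_le\<close> applies.\<close>

lemma card_sphere_leave_ball_le:
  assumes "v \<in> V" "w \<in> V" "m \<le> d"
  shows "real (card {z \<in> sphere v m. m < dist w z})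
    \<le> card (sphere v m) * (b m * (\<Sum>t = 1..dist v w. 1 / real (b (t - 1))))"
proof -
  define s where "s = dist v w"
  define \<Sigma> where "\<Sigma> = (\<Sum>t = 1..s. 1 / real (b (t - 1)))"
  define F where "F w = card {z \<in> sphere v m. m < dist w z}" for w
  have "s \<le> d" using assms dist_le by (simp add: s_def)
  have F_eq: "F w' = F w" if "w' \<in> sphere v s" for w'
  proof -
    have F_sum: "F x = (\<Sum>l\<le>d. of_bool (m < l) * inter v x m l)" if "x \<in> V" for x
    proof -
      have "F x = (\<Sum>z\<in>sphere v m. of_bool (m < dist x z))"
        by (simp add: F_def of_bool_def sum.If_cases Int_def)
      then show ?thesis using sum_sphere_by_dist[OF that, of "\<lambda>l. of_bool (m < l)"] by simp
    qed
    have "inter v w' m l = inter v w m l" for l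
      using that assms by (intro inter_eq) (auto simp: sphere_def s_def)
    then show ?thesis using F_sum[of w'] F_sum[of w] that assms by (simp add: sphere_def)
  qed
  have cross: "real (card {x \<in> sphere v s. m < dist z x}) \<le> card (sphere v s) * (b m * \<Sigma>)"
    if z: "z \<in> sphere v m" for z
  proof -
    \<comment> \<open>A single step can leave the ball only from distance exactly
      \<open>m\<close>.\<close>
    have "card {x'. E x x' \<and> dist z x' \<in> {m<..}} \<le> b m" if "x \<in> V" "dist z x \<notin> {m<..}" for x
    proof (cases "dist z x = m")
      case True
      have "{x'. E x x' \<and> dist z x' \<in> {m<..}} = {x'. E x x' \<and> dist z x' = dist z x + 1}"
        using True dist_adj[of z x] z by (fastforce simp: sphere_def)
      then show ?thesis using card_b[of z x] True that z by (simp add: sphere_def)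
    next
      case False
      then have "{x'. E x x' \<and> dist z x' \<in> {m<..}} = {}"
        using that dist_adj[of z x] z by (fastforce simp: sphere_def)
      then show ?thesis by (simp only: card.empty)
    qed
    then show ?thesis
      using card_crossing_le[of v z "{m<..}" s "b m"] z assms \<open>s \<le> d\<close> dist_sym[of v z]
      by (simp add: sphere_def \<Sigma>_def)
  qed
  have "card (sphere v s) * F w = (\<Sum>w'\<in>sphere v s. F w')"
    using F_eq by simp
  also have "\<dots> = (\<Sum>z\<in>sphere v m. card {x \<in> sphere v s. m < dist z x})"
    unfolding F_def by (subst sum_card_swap) (simp_all add: dist_sym)
  finally have "real (card (sphere v s)) * F w
      = (\<Sum>z\<in>sphere v m. real (card {x \<in> sphere v s. m < dist z x}))"
    by (metis of_nat_mult of_nat_sum)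
  also have "\<dots> \<le> card (sphere v m) * (card (sphere v s) * (b m * \<Sigma>))"
    by (rule sum_bounded_above) (rule cross)
  finally have "card (sphere v s) * real (F w) \<le> card (sphere v s) * (card (sphere v m) * (b m * \<Sigma>))"
    by (simp add: mult_ac)
  then show ?thesis
    using sphere_nonempty[of v s] assms \<open>s \<le> d\<close> by (simp add: F_def \<Sigma>_def s_def)
qed

lemma card_sphere_enter_ball_le:
  assumes "v \<in> V" "w \<in> V" "dist v w = Suc m"
  shows "real (card {z \<in> sphere v m. dist w z \<le> m})
    \<le> card (sphere v m) * (c (Suc m) * (\<Sum>t = 1..m. 1 / real (b (t - 1))))"
proof -
  have "card {x'. E x x' \<and> dist w x' \<in> {..m}} \<le> c (Suc m)" if "x \<in> V" "dist w x \<notin> {..m}" for x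
  proof (cases "dist w x = Suc m")
    case True
    have "{x'. E x x' \<and> dist w x' \<in> {..m}} = {x'. E x x' \<and> dist w x' + 1 = dist w x}"
      using True dist_adj[of w x] assms by fastforce
    then show ?thesis using card_c[of w x] True that assms by simp
  next
    case False
    then have "{x'. E x x' \<and> dist w x' \<in> {..m}} = {}"
      using that dist_adj[of w x] assms by fastforce
    then show ?thesis by (simp only: card.empty)
  qed
  then show ?thesis
    using card_crossing_le[of v w "{..m}" m "c (Suc m)"] assms dist_sym[of v w] dist_le[of v w]
    by simp
qed

section \<open>Growth of spheres\<close>

lemma
  assumes "i \<le> j" "j \<le> d"
  shows b_antimono: "b j \<le> b i" and c_mono: "c i \<le> c j"
  using assms
proof (induction j rule: dec_induct)
  case (step n)
  { case 1 then show ?case using step b_Suc_le[of n] by simp }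
  { case 2 then show ?case using step c_le_Suc[of n] by simp }
qed auto

text \<open>Monotonicity of \<open>b\<close> and \<open>c\<close> gives
  \<open>C \<le> b i / c (Suc i)\<close> for \<open>i \<le> j\<close>, so each sphere is at least
  \<open>C\<close> times the previous one. Adding \<open>C - 1\<close> times the next sphere to the
  induction hypothesis then reproduces the claim.\<close>

lemma sum_card_sphere_le:
  assumes "v \<in> V" "j < d" "C = real (b j) / real (c (Suc j))" "1 < C" "i \<le> j"
  shows "(C - 1) * (\<Sum>l\<le>i. real (card (sphere v l))) \<le> card (sphere v (Suc i))"
  using \<open>i \<le> j\<close>
proof (induction i)
  have growth: "C * card (sphere v i) \<le> card (sphere v (Suc i))" if "i \<le> j" for i
  proof -
    have pos: "0 < c (Suc i)" "0 < c (Suc j)" using c_pos that assms by auto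
    have "C \<le> real (b i) / c (Suc i)"
      unfolding assms(3) using b_antimono[of i j] c_mono[of "Suc i" "Suc j"] pos that assms
      by (intro frac_le) auto
    moreover have "real (card (sphere v (Suc i))) * c (Suc i) = card (sphere v i) * b i"
      using card_sphere_Suc[OF assms(1), of i] by (metis of_nat_mult)
    ultimately have "real (card (sphere v i)) * (b i / c (Suc i)) = card (sphere v (Suc i))"
      using pos by (simp add: field_simps)
    then show ?thesis
      using mult_left_mono[OF \<open>C \<le> b i / c (Suc i)\<close>, of "card (sphere v i)"] by (simp add: mult_ac)
  qed
  {
    case 0
    then show ?case using growth[of 0] by (simp add: algebra_simps)
  next
    case (Suc i)
    then show ?case using growth[of "Suc i"] by (simp add: algebra_simps)
  }
qed

end

theorem theorem3p2:
  fixes V :: "'a set" and E :: "'a \<Rightarrow> 'a \<Rightarrow> bool"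
    and d j s :: nat and a b c :: "nat \<Rightarrow> nat" and C :: real
  assumes "distance_regular V E d a b c"
    and "d \<ge> 2"
    and "j \<le> d - 2"
    and "b j > c (j + 1)"
    and "C = real (b j) / real (c (j + 1))"
    and "1 \<le> s" and "s \<le> j + 1"
  shows "real (b (j + 1)) * ((\<Sum>t = 1..s. 1 / real (b (t - 1)))
            + (\<Sum>t = 1..j + 2 - s. 1 / real (b (t - 1))))
         + real (c (j + 2)) * (\<Sum>t = 1..j + 1. 1 / real (b (t - 1)))
         \<ge> 1 - 4 / (C - 1)"
proof -
  interpret distance_regular_graph V E d a b c
    by unfold_locales (rule assms(1))
  define m where "m = j + 1"
  define \<sigma> where "\<sigma> i = (\<Sum>t = 1..i. 1 / real (b (t - 1)))" for i
  have m: "Suc m \<le> d" using assms by (simp add: m_def)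
  have "0 < c (Suc j)" using c_pos m by (simp add: m_def)
  then have C: "1 < C" using assms by simp
  obtain v w where vw: "v \<in> V" "w \<in> V" "dist v w = Suc m"
    using ex_pair_at_dist m by blast
  \<comment> \<open>\<open>s \<le> j + 1\<close> makes the natural subtraction exact.\<close>
  then have "dist v w = s + (j + 2 - s)" using assms by (simp add: m_def)
  then obtain u where u: "u \<in> V" "dist v u = s" "dist u w = j + 2 - s"
    using geodesic_point vw by metis
  define k where "k = real (card (sphere u m))"
  have k: "0 < k" "k = card (sphere v m)"
    using sphere_nonempty[of u m] card_sphere_eq[of u v] u vw m by (auto simp: k_def)
  define Fv where "Fv = {z \<in> sphere u m. m < dist v z}"
  define Fw where "Fw = {z \<in> sphere u m. m < dist w z}"
  define G where "G = {z \<in> sphere v m. dist w z \<le> m}"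
  define B where "B = (\<Union>l\<le>j. sphere v l)"
  have Fv: "real (card Fv) \<le> k * (b m * \<sigma> s)"
    using card_sphere_leave_ball_le[of u v m] u vw m dist_sym[of u v]
    by (simp add: Fv_def k_def \<sigma>_def)
  have Fw: "real (card Fw) \<le> k * (b m * \<sigma> (j + 2 - s))"
    using card_sphere_leave_ball_le[of u w m] u vw m by (simp add: Fw_def k_def \<sigma>_def)
  have G: "real (card G) \<le> k * (c (Suc m) * \<sigma> m)"
    using card_sphere_enter_ball_le[OF vw] k by (simp add: G_def \<sigma>_def)
  have "real (card B) \<le> (\<Sum>l\<le>j. real (card (sphere v l)))"
    using card_UN_le[of "{..j}" "sphere v"] unfolding B_def
    by (metis finite_atMost of_nat_le_iff of_nat_sum)
  also have "\<dots> \<le> k / (C - 1)"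
    using sum_card_sphere_le[of v j C j] vw m C assms k
    by (simp add: m_def field_simps)
  finally have B: "real (card B) \<le> k * (1 / (C - 1))" by simp
  \<comment> \<open>A vertex outside \<open>Fv\<close> and \<open>Fw\<close> is within
    \<open>m\<close> of both \<open>v\<close> and \<open>w\<close>. If its distance from
    \<open>v\<close> is exactly \<open>m = j + 1\<close> it lies in \<open>G\<close>, otherwise in
    \<open>B\<close>.\<close>
  have "sphere u m \<subseteq> (Fv \<union> Fw) \<union> (G \<union> B)"
    by (auto simp: Fv_def Fw_def G_def B_def sphere_def m_def)
  then have "card (sphere u m) \<le> card ((Fv \<union> Fw) \<union> (G \<union> B))"
    by (intro card_mono) (auto simp: Fv_def Fw_def G_def B_def)
  also have "\<dots> \<le> card Fv + card Fw + (card G + card B)"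
    by (meson add_mono card_Un_le order_trans)
  finally have "k \<le> real (card Fv) + card Fw + (card G + card B)"
    unfolding k_def by (metis of_nat_add of_nat_mono)
  also have "\<dots> \<le> k * (b m * (\<sigma> s + \<sigma> (j + 2 - s)) + c (Suc m) * \<sigma> m + 1 / (C - 1))"
    using Fv Fw G B by (simp add: algebra_simps)
  finally have "1 \<le> b m * (\<sigma> s + \<sigma> (j + 2 - s)) + c (Suc m) * \<sigma> m + 1 / (C - 1)"
    using k by simp
  \<comment> \<open>The covering loses only \<open>1 / (C - 1)\<close>; this is relaxed to the
    stated error term.\<close>
  moreover have "1 / (C - 1) \<le> 4 / (C - 1)"
    using C by (intro divide_right_mono) auto
  ultimately show ?thesis
    by (simp add: m_def \<sigma>_def)
qed

end
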